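(* Let $\alpha,\beta,\gamma\in\mathbb{R}$ satisfy $\alpha>-\frac12$, $\gamma>-1$ and $\alpha+\beta+\gamma>-\frac32$, and let $$X_t=\int_0^t s^{\alpha}\int_s^t u^{\beta}(u-s)^{\gamma}\,du\,dW_s,\qquad t\ge 0,$$ where $W$ is a Wiener process. Then $$\mathsf{E}[X_1(X_{t+1}-X_t)]\sim\frac{\mathrm{B}(2\alpha+1,\gamma+1)}{2\alpha+\beta+\gamma+2}\,t^{\beta+\gamma}\qquad\text{as } t\to+\infty.$$ If $\beta+\gamma<-1$, then $$\sum_{n=1}^\infty\operatorname{cov}(X_1,X_{n+1}-X_n)<\infty\quad\text{and}\quad\int_0^\infty\operatorname{cov}(X_1,X_{t+1}-X_t)\,dt<\infty,$$ and thus the process $X$ is short-range dependent. Otherwise, if $\beta+\gamma\ge-1$, then $$\sum_{n=1}^\infty\operatorname{cov}(X_1,X_{n+1}-X_n)=\infty\quad\text{and}\quad\int_1^\infty\operatorname{cov}(X_1,X_{t+1}-X_t)\,dt=\infty,$$ and the process $X$ is long-range dependent.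
   Context: $W=\{W_t,\ t\ge0\}$ is a standard Wiener process, and the outer integral defining $X_t$ is the Wiener integral of the deterministic kernel $K(t,s)=s^\alpha\int_s^t u^\beta(u-s)^\gamma\,du$, $0<s<t$ (with $X_0=0$); under the stated conditions the process is well defined. $\mathrm{B}(a,b)=\int_0^1 y^{a-1}(1-y)^{b-1}\,dy$ is the beta function. $f(t)\sim g(t)$ means $f(t)/g(t)\to1$. Definition. A stochastic process $\{X_t,\ t\ge0\}$ with finite second moments is called short-range dependent if $\sum_{n=1}^\infty|\operatorname{cov}(X_1,X_{n+1}-X_n)|<\infty$, and long-range dependent if $\sum_{n=1}^\infty|\operatorname{cov}(X_1,X_{n+1}-X_n)|=\infty$. *)

theory Defs
  imports "HOL-Probability.Probability"
begin

definition increasing_times :: "nat \<Rightarrow> (nat \<Rightarrow> real) \<Rightarrow> bool" where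
  "increasing_times n p \<longleftrightarrow> 0 \<le> p 0 \<and> (\<forall>i<n. p i < p (Suc i))"

locale wiener_process = prob_space M
  for M :: "'a measure" and W :: "real \<Rightarrow> 'a \<Rightarrow> real" +
  assumes random_variable_W: "\<And>t. 0 \<le> t \<Longrightarrow> W t \<in> borel_measurable M"
    and W_0: "AE \<omega> in M. W 0 \<omega> = 0"
    and indep_increments: "\<And>n p. increasing_times n p \<Longrightarrow>
      indep_vars (\<lambda>_. borel) (\<lambda>i \<omega>. W (p (Suc i)) \<omega> - W (p i) \<omega>) {..<n}"
    and normal_increments: "\<And>s t. 0 \<le> s \<Longrightarrow> s < t \<Longrightarrow>
      distributed M lborel (\<lambda>\<omega>. W t \<omega> - W s \<omega>) (normal_density 0 (sqrt (t - s)))"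
    and continuous_paths: "AE \<omega> in M. continuous_on {0..} (\<lambda>t. W t \<omega>)"

definition step_fun :: "nat \<Rightarrow> (nat \<Rightarrow> real) \<Rightarrow> (nat \<Rightarrow> real) \<Rightarrow> real \<Rightarrow> real" where
  "step_fun n c p s = (\<Sum>i<n. c i * indicator {p i<..p (Suc i)} s)"

definition step_integral ::
  "(real \<Rightarrow> 'a \<Rightarrow> real) \<Rightarrow> nat \<Rightarrow> (nat \<Rightarrow> real) \<Rightarrow> (nat \<Rightarrow> real) \<Rightarrow> 'a \<Rightarrow> real" where
  "step_integral W n c p \<omega> = (\<Sum>i<n. c i * (W (p (Suc i)) \<omega> - W (p i) \<omega>))"

(* I is a version of the Wiener integral of f over (0, oo): the mean-square limit of the
   integrals of step functions converging to f in L^2(0, oo). By the Ito isometry, I is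
   determined up to a null set and does not depend on the approximating sequence. The integral
   over (0, t) is that of a function vanishing outside (0, t). *)
definition has_wiener_integral ::
  "'a measure \<Rightarrow> (real \<Rightarrow> 'a \<Rightarrow> real) \<Rightarrow> (real \<Rightarrow> real) \<Rightarrow> ('a \<Rightarrow> real) \<Rightarrow> bool" where
  "has_wiener_integral M W f I \<longleftrightarrow>
     set_borel_measurable lborel {0<..} f \<and>
     set_integrable lborel {0<..} (\<lambda>s. (f s)\<^sup>2) \<and>
     I \<in> borel_measurable M \<and>
     integrable M (\<lambda>\<omega>. (I \<omega>)\<^sup>2) \<and>
     (\<exists>(n :: nat \<Rightarrow> nat) (c :: nat \<Rightarrow> nat \<Rightarrow> real) (p :: nat \<Rightarrow> nat \<Rightarrow> real).
        (\<forall>k. increasing_times (n k) (p k)) \<and>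
        (\<lambda>k. \<integral>\<^sup>+s\<in>{0<..}. ennreal ((f s - step_fun (n k) (c k) (p k) s)\<^sup>2) \<partial>lborel)
          \<longlonglongrightarrow> 0 \<and>
        (\<lambda>k. \<integral>\<^sup>+\<omega>. ennreal ((I \<omega> - step_integral W (n k) (c k) (p k) \<omega>)\<^sup>2) \<partial>M)
          \<longlonglongrightarrow> 0)"

definition volterra_kernel :: "real \<Rightarrow> real \<Rightarrow> real \<Rightarrow> real \<Rightarrow> real \<Rightarrow> real" where
  "volterra_kernel \<alpha> \<beta> \<gamma> t s =
     (if 0 < s \<and> s < t
      then s powr \<alpha> * (LINT u:{s<..<t}|lborel. u powr \<beta> * (u - s) powr \<gamma>)
      else 0)"

definition covariance :: "'a measure \<Rightarrow> ('a \<Rightarrow> real) \<Rightarrow> ('a \<Rightarrow> real) \<Rightarrow> real" where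
  "covariance M X Y =
     (\<integral>\<omega>. (X \<omega> - (\<integral>\<omega>'. X \<omega>' \<partial>M)) * (Y \<omega> - (\<integral>\<omega>'. Y \<omega>' \<partial>M)) \<partial>M)"

definition incr_cov :: "'a measure \<Rightarrow> (real \<Rightarrow> 'a \<Rightarrow> real) \<Rightarrow> real \<Rightarrow> real" where
  "incr_cov M X t = covariance M (X 1) (\<lambda>\<omega>. X (t + 1) \<omega> - X t \<omega>)"

definition finite_second_moments :: "'a measure \<Rightarrow> (real \<Rightarrow> 'a \<Rightarrow> real) \<Rightarrow> bool" where
  "finite_second_moments M X \<longleftrightarrow>
     (\<forall>t\<ge>0. X t \<in> borel_measurable M \<and> integrable M (\<lambda>\<omega>. (X t \<omega>)\<^sup>2))"

(* The sums over n = 1, 2, ... are reindexed by n = Suc k. *)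
definition short_range_dependent :: "'a measure \<Rightarrow> (real \<Rightarrow> 'a \<Rightarrow> real) \<Rightarrow> bool" where
  "short_range_dependent M X \<longleftrightarrow>
     finite_second_moments M X \<and> summable (\<lambda>k. \<bar>incr_cov M X (real (Suc k))\<bar>)"

definition long_range_dependent :: "'a measure \<Rightarrow> (real \<Rightarrow> 'a \<Rightarrow> real) \<Rightarrow> bool" where
  "long_range_dependent M X \<longleftrightarrow>
     finite_second_moments M X \<and> \<not> summable (\<lambda>k. \<bar>incr_cov M X (real (Suc k))\<bar>)"

end

theory Submission
  imports Defs
begin

text \<open>By the Ito isometry the covariance of \<open>X 1\<close> and \<open>X (t + 1) - X t\<close> is the integral over \<open>(0, 1)\<close> of
  \<open>K 1 s * (K (t + 1) s - K t s)\<close>, where \<open>K\<close> is the Volterra kernel. For \<open>0 < s < 1 < t\<close> the kernel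
  increment is \<open>s powr \<alpha>\<close> times the integral of \<open>u powr \<beta> * (u - s) powr \<gamma>\<close> over \<open>(t, t + 1)\<close>. There
  both \<open>u / t\<close> and \<open>(u - s) / t\<close> lie between \<open>1 - 1 / t\<close> and \<open>1 + 1 / t\<close>, so the increment is
  \<open>s powr \<alpha> * t powr (\<beta> + \<gamma>)\<close> up to a factor that tends to 1 uniformly in \<open>s\<close>. The constant is
  therefore the integral of \<open>s powr \<alpha> * K 1 s\<close>, which Tonelli's theorem reduces to a Beta integral.
  Since \<open>K\<close> is nonnegative and monotone in \<open>t\<close>, the covariance is the increment of a monotone
  function. It is thus nonnegative and locally integrable, and its decay rate decides between
  short-range and long-range dependence.\<close>

section \<open>Mean-square convergence\<close>

text \<open>Domination by the sum of the two squares, since twice the product of two reals is at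
  most that sum in absolute value.\<close>

lemma integrable_mult_L2:
  fixes f g :: "'a \<Rightarrow> real"
  assumes [measurable]: "f \<in> borel_measurable M" "g \<in> borel_measurable M"
    and "integrable M (\<lambda>x. (f x)\<^sup>2)" "integrable M (\<lambda>x. (g x)\<^sup>2)"
  shows "integrable M (\<lambda>x. f x * g x)"
proof (rule Bochner_Integration.integrable_bound)
  show "integrable M (\<lambda>x. (f x)\<^sup>2 + (g x)\<^sup>2)"
    using assms by simp
  have "\<bar>a * b\<bar> \<le> a\<^sup>2 + b\<^sup>2" for a b :: real
  proof -
    have "2 * \<bar>a * b\<bar> \<le> a\<^sup>2 + b\<^sup>2"
      using sum_squares_bound[of "\<bar>a\<bar>" "\<bar>b\<bar>"] by (simp add: abs_mult mult.assoc)
    then show ?thesis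
      using abs_ge_zero[of "a * b"] by linarith
  qed
  then show "AE x in M. norm (f x * g x) \<le> norm ((f x)\<^sup>2 + (g x)\<^sup>2)"
    by (auto simp: abs_mult)
qed measurable

text \<open>The inequality for nonnegative extended integrals is applied to the absolute values.
  Square integrability keeps all the quantities finite, so that the bound passes to real
  integrals.\<close>

lemma Cauchy_Schwarz_integral:
  fixes f g :: "'a \<Rightarrow> real"
  assumes [measurable]: "f \<in> borel_measurable M" "g \<in> borel_measurable M"
    and f2: "integrable M (\<lambda>x. (f x)\<^sup>2)" and g2: "integrable M (\<lambda>x. (g x)\<^sup>2)"
  shows "\<bar>\<integral>x. f x * g x \<partial>M\<bar> \<le> sqrt (\<integral>x. (f x)\<^sup>2 \<partial>M) * sqrt (\<integral>x. (g x)\<^sup>2 \<partial>M)"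
proof -
  have fg: "integrable M (\<lambda>x. f x * g x)"
    by (rule integrable_mult_L2) fact+
  define c where "c = (\<integral>x. \<bar>f x * g x\<bar> \<partial>M)"
  have "ennreal (c\<^sup>2) = (\<integral>\<^sup>+x. ennreal \<bar>f x\<bar> * ennreal \<bar>g x\<bar> \<partial>M)\<^sup>2"
    using fg by (simp add: c_def flip: ennreal_mult abs_mult ennreal_power)
      (simp add: nn_integral_eq_integral)
  also have "\<dots> \<le> (\<integral>\<^sup>+x. ennreal \<bar>f x\<bar> ^ 2 \<partial>M) * (\<integral>\<^sup>+x. ennreal \<bar>g x\<bar> ^ 2 \<partial>M)"
    by (rule Cauchy_Schwarz_nn_integral) measurable
  also have "\<dots> = ennreal ((\<integral>x. (f x)\<^sup>2 \<partial>M) * (\<integral>x. (g x)\<^sup>2 \<partial>M))"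
    using f2 g2 by (simp add: ennreal_power nn_integral_eq_integral ennreal_mult)
  finally have "c\<^sup>2 \<le> (\<integral>x. (f x)\<^sup>2 \<partial>M) * (\<integral>x. (g x)\<^sup>2 \<partial>M)"
    by (simp add: ennreal_le_iff)
  then have "c \<le> sqrt (\<integral>x. (f x)\<^sup>2 \<partial>M) * sqrt (\<integral>x. (g x)\<^sup>2 \<partial>M)"
    by (simp add: real_le_rsqrt flip: real_sqrt_mult)
  moreover have "\<bar>\<integral>x. f x * g x \<partial>M\<bar> \<le> c"
    unfolding c_def by (rule integral_abs_bound)
  ultimately show ?thesis
    by linarith
qed

text \<open>Joint continuity of the inner product in mean square. It is applied on the probability
  space and on the real line, where it carries the isometry from step functions to their limits. The
  convergence hypotheses have the form found in \<open>has_wiener_integral\<close>.\<close>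

lemma L2_tendsto_integral_mult:
  fixes f g :: "'a \<Rightarrow> real" and F G :: "nat \<Rightarrow> 'a \<Rightarrow> real"
  assumes [measurable]: "f \<in> borel_measurable M" "g \<in> borel_measurable M"
      "\<And>k. F k \<in> borel_measurable M" "\<And>k. G k \<in> borel_measurable M"
    and f2: "integrable M (\<lambda>x. (f x)\<^sup>2)" and g2: "integrable M (\<lambda>x. (g x)\<^sup>2)"
    and F2: "\<And>k. integrable M (\<lambda>x. (F k x)\<^sup>2)" and G2: "\<And>k. integrable M (\<lambda>x. (G k x)\<^sup>2)"
    and F: "(\<lambda>k. \<integral>\<^sup>+x. ennreal ((f x - F k x)\<^sup>2) \<partial>M) \<longlonglongrightarrow> 0"
    and G: "(\<lambda>k. \<integral>\<^sup>+x. ennreal ((g x - G k x)\<^sup>2) \<partial>M) \<longlonglongrightarrow> 0"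
  shows "(\<lambda>k. \<integral>x. F k x * G k x \<partial>M) \<longlonglongrightarrow> (\<integral>x. f x * g x \<partial>M)"
proof -
  have diff: "integrable M (\<lambda>x. (u x - v x)\<^sup>2)"
    if [measurable]: "u \<in> borel_measurable M" "v \<in> borel_measurable M"
      and "integrable M (\<lambda>x. (u x)\<^sup>2)" "integrable M (\<lambda>x. (v x)\<^sup>2)" for u v :: "'a \<Rightarrow> real"
  proof -
    have "integrable M (\<lambda>x. (u x)\<^sup>2 + (v x)\<^sup>2 - 2 * (u x * v x))"
      using that integrable_mult_L2[of u M v] by simp
    then show ?thesis
      by (simp add: power2_diff mult.assoc)
  qed
  have fF: "integrable M (\<lambda>x. (f x - F k x)\<^sup>2)" and gG: "integrable M (\<lambda>x. (g x - G k x)\<^sup>2)" for k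
    by (rule diff; fact)+
  \<comment> \<open>Square integrability of the differences turns convergence of extended integrals
    into convergence of real norms, to which Cauchy-Schwarz applies.\<close>
  have real: "(\<lambda>k. sqrt (\<integral>x. (D k x)\<^sup>2 \<partial>M)) \<longlonglongrightarrow> 0"
    if "\<And>k. integrable M (\<lambda>x. (D k x)\<^sup>2)" "(\<lambda>k. \<integral>\<^sup>+x. ennreal ((D k x)\<^sup>2) \<partial>M) \<longlonglongrightarrow> 0"
    for D :: "nat \<Rightarrow> 'a \<Rightarrow> real"
  proof -
    have "(\<lambda>k. ennreal (\<integral>x. (D k x)\<^sup>2 \<partial>M)) \<longlonglongrightarrow> ennreal 0"
      using that by (simp add: nn_integral_eq_integral)
    then have "(\<lambda>k. \<integral>x. (D k x)\<^sup>2 \<partial>M) \<longlonglongrightarrow> 0"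
      by (subst (asm) tendsto_ennreal_iff) auto
    from tendsto_real_sqrt[OF this] show ?thesis by simp
  qed
  let ?a = "\<lambda>k. sqrt (\<integral>x. (f x - F k x)\<^sup>2 \<partial>M)" and ?b = "\<lambda>k. sqrt (\<integral>x. (g x - G k x)\<^sup>2 \<partial>M)"
  let ?f = "sqrt (\<integral>x. (f x)\<^sup>2 \<partial>M)" and ?g = "sqrt (\<integral>x. (g x)\<^sup>2 \<partial>M)"
  have lim: "(\<lambda>k. ?f * ?b k + ?g * ?a k + ?a k * ?b k) \<longlonglongrightarrow> ?f * 0 + ?g * 0 + 0 * 0"
    by (intro tendsto_intros real fF gG F G)
  have bound: "\<bar>(\<integral>x. F k x * G k x \<partial>M) - (\<integral>x. f x * g x \<partial>M)\<bar> \<le> ?f * ?b k + ?g * ?a k + ?a k * ?b k" for k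
  proof -
    have i1: "integrable M (\<lambda>x. f x * (g x - G k x))"
      and i2: "integrable M (\<lambda>x. g x * (f x - F k x))"
      and i3: "integrable M (\<lambda>x. (f x - F k x) * (g x - G k x))"
      and i4: "integrable M (\<lambda>x. f x * g x)"
      by (intro integrable_mult_L2; measurable; fact)+
    \<comment> \<open>Writing \<open>F = f - (f - F)\<close> and \<open>G = g - (g - G)\<close>
      leaves three error terms, each with at least one small factor.\<close>
    have "(\<integral>x. F k x * G k x \<partial>M) = (\<integral>x. f x * g x - f x * (g x - G k x) - g x * (f x - F k x)
        + (f x - F k x) * (g x - G k x) \<partial>M)"
      by (intro Bochner_Integration.integral_cong) (auto simp: algebra_simps)
    also have "\<dots> = (\<integral>x. f x * g x \<partial>M) - (\<integral>x. f x * (g x - G k x) \<partial>M)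
        - (\<integral>x. g x * (f x - F k x) \<partial>M) + (\<integral>x. (f x - F k x) * (g x - G k x) \<partial>M)"
      using i1 i2 i3 i4 by simp
    finally show ?thesis
      using Cauchy_Schwarz_integral[of f M "\<lambda>x. g x - G k x", OF _ _ f2 gG]
        Cauchy_Schwarz_integral[of g M "\<lambda>x. f x - F k x", OF _ _ g2 fF]
        Cauchy_Schwarz_integral[of "\<lambda>x. f x - F k x" M "\<lambda>x. g x - G k x", OF _ _ fF gG]
      by simp
  qed
  have "(\<lambda>k. (\<integral>x. F k x * G k x \<partial>M) - (\<integral>x. f x * g x \<partial>M)) \<longlonglongrightarrow> 0"
    by (rule Lim_null_comparison[OF _ lim[simplified]]) (auto simp: bound)
  then show ?thesis
    by (rule LIM_zero_cancel)
qed

section \<open>The Ito isometry\<close>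

context wiener_process
begin

text \<open>The moments are those of a centred normal variable with standard deviation
  \<open>sqrt (t - s)\<close>. The times may come in either order, hence the absolute value:
  polarization compares all endpoints of two intervals.\<close>

lemma W_increment_L2:
  assumes "0 \<le> s" "0 \<le> t"
  shows "integrable M (\<lambda>\<omega>. (W t \<omega> - W s \<omega>)\<^sup>2)"
    and "(\<integral>\<omega>. (W t \<omega> - W s \<omega>)\<^sup>2 \<partial>M) = \<bar>t - s\<bar>"
    and "integrable M (\<lambda>\<omega>. W t \<omega> - W s \<omega>)"
    and "(\<integral>\<omega>. W t \<omega> - W s \<omega> \<partial>M) = 0"
proof -
  have *: "integrable M (\<lambda>\<omega>. (W t \<omega> - W s \<omega>)\<^sup>2) \<and> (\<integral>\<omega>. (W t \<omega> - W s \<omega>)\<^sup>2 \<partial>M) = t - s \<and>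
      integrable M (\<lambda>\<omega>. W t \<omega> - W s \<omega>) \<and> (\<integral>\<omega>. W t \<omega> - W s \<omega> \<partial>M) = 0"
    if st: "0 \<le> s" "s < t" for s t
  proof -
    note D = normal_increments[OF st]
    have s: "0 < sqrt (t - s)" using st by simp
    have 1: "integrable M (\<lambda>\<omega>. W t \<omega> - W s \<omega>)"
      using distributed_integrable[OF D, of "\<lambda>x. x"] integrable_normal_moment_nz_1[OF s, of 0] by simp
    have 2: "integrable M (\<lambda>\<omega>. (W t \<omega> - W s \<omega>)\<^sup>2)"
      using distributed_integrable[OF D, of "\<lambda>x. x\<^sup>2"] integrable_normal_moment[OF s, of 0 2] by simp
    have 3: "(\<integral>\<omega>. W t \<omega> - W s \<omega> \<partial>M) = 0"
      by (rule normal_distributed_expectation[OF s D])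
    have "(\<integral>\<omega>. (W t \<omega> - W s \<omega>)\<^sup>2 \<partial>M) = (sqrt (t - s))\<^sup>2"
      using normal_distributed_variance[OF s D] 3 by simp
    with 1 2 3 st show ?thesis by simp
  qed
  consider "s < t" | "s = t" | "t < s" by linarith
  then have "integrable M (\<lambda>\<omega>. (W t \<omega> - W s \<omega>)\<^sup>2) \<and> (\<integral>\<omega>. (W t \<omega> - W s \<omega>)\<^sup>2 \<partial>M) = \<bar>t - s\<bar> \<and>
      integrable M (\<lambda>\<omega>. W t \<omega> - W s \<omega>) \<and> (\<integral>\<omega>. W t \<omega> - W s \<omega> \<partial>M) = 0"
  proof cases
    case 1
    with *[OF assms(1) 1] show ?thesis by simp
  next
    case 2
    then show ?thesis by simp
  next
    case 3
    note w = *[OF assms(2) 3]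
    have "integrable M (\<lambda>\<omega>. - (W s \<omega> - W t \<omega>))"
      using w by (intro Bochner_Integration.integrable_minus) blast
    moreover have "(\<integral>\<omega>. - (W s \<omega> - W t \<omega>) \<partial>M) = 0"
      using w unfolding Bochner_Integration.integral_minus by simp
    ultimately have "integrable M (\<lambda>\<omega>. W t \<omega> - W s \<omega>)" "(\<integral>\<omega>. W t \<omega> - W s \<omega> \<partial>M) = 0"
      unfolding minus_diff_eq by blast+
    with w 3 show ?thesis by (simp add: power2_commute[of "W t _"])
  qed
  then show "integrable M (\<lambda>\<omega>. (W t \<omega> - W s \<omega>)\<^sup>2)"
    and "(\<integral>\<omega>. (W t \<omega> - W s \<omega>)\<^sup>2 \<partial>M) = \<bar>t - s\<bar>"
    and "integrable M (\<lambda>\<omega>. W t \<omega> - W s \<omega>)"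
    and "(\<integral>\<omega>. W t \<omega> - W s \<omega> \<partial>M) = 0"
    by blast+
qed

text \<open>Polarization expresses the product of two increments by squares of increments, so that
  independence of increments is not needed here.\<close>

lemma integral_W_increments_mult:
  assumes "0 \<le> a" "a \<le> b" "0 \<le> c" "c \<le> d"
  shows "integrable M (\<lambda>\<omega>. (W b \<omega> - W a \<omega>) * (W d \<omega> - W c \<omega>))"
    and "(\<integral>\<omega>. (W b \<omega> - W a \<omega>) * (W d \<omega> - W c \<omega>) \<partial>M)
      = (\<integral>s. indicator {a<..b} s * indicator {c<..d} s \<partial>lborel)"
proof -
  have eq: "(\<lambda>\<omega>. (W b \<omega> - W a \<omega>) * (W d \<omega> - W c \<omega>)) = (\<lambda>\<omega>. ((W b \<omega> - W c \<omega>)\<^sup>2 + (W a \<omega> - W d \<omega>)\<^sup>2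
      - (W b \<omega> - W d \<omega>)\<^sup>2 - (W a \<omega> - W c \<omega>)\<^sup>2) / 2)"
    by (auto simp: power2_eq_square algebra_simps)
  have nn: "0 \<le> b" "0 \<le> d" using assms by auto
  note i = W_increment_L2(1)[OF \<open>0 \<le> c\<close> \<open>0 \<le> b\<close>] W_increment_L2(1)[OF \<open>0 \<le> d\<close> \<open>0 \<le> a\<close>]
    W_increment_L2(1)[OF \<open>0 \<le> d\<close> \<open>0 \<le> b\<close>] W_increment_L2(1)[OF \<open>0 \<le> c\<close> \<open>0 \<le> a\<close>]
  show "integrable M (\<lambda>\<omega>. (W b \<omega> - W a \<omega>) * (W d \<omega> - W c \<omega>))"
    unfolding eq using i by simp
  have "(\<integral>\<omega>. (W b \<omega> - W a \<omega>) * (W d \<omega> - W c \<omega>) \<partial>M) = (\<bar>b - c\<bar> + \<bar>a - d\<bar> - \<bar>b - d\<bar> - \<bar>a - c\<bar>) / 2"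
    unfolding eq using i assms nn by (simp add: W_increment_L2(2))
  \<comment> \<open>The four distances combine to twice the length of the overlap of the two
    intervals, which is 0 if they are disjoint.\<close>
  also have "\<dots> = max 0 (min b d - max a c)"
    using assms by (auto simp: max_def min_def field_simps)
  also have "\<dots> = measure lborel {max a c<..min b d}"
    by (cases "max a c \<le> min b d") (simp_all del: max.bounded_iff min.bounded_iff)
  also have "\<dots> = (\<integral>s. indicator {max a c<..min b d} s \<partial>lborel)"
    by simp
  also have "\<dots> = (\<integral>s. indicator {a<..b} s * indicator {c<..d} s \<partial>lborel)"
    by (intro Bochner_Integration.integral_cong) (auto simp: indicator_def)
  finally show "(\<integral>\<omega>. (W b \<omega> - W a \<omega>) * (W d \<omega> - W c \<omega>) \<partial>M)
      = (\<integral>s. indicator {a<..b} s * indicator {c<..d} s \<partial>lborel)" .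
qed

text \<open>Nonnegativity spreads from \<open>p 0\<close> by induction along neighbouring times. It
  gives access to the properties of \<open>W\<close>, which are stated for nonnegative
  times.\<close>

lemma increasing_times_Suc:
  assumes "increasing_times n p" "i < n"
  shows "0 \<le> p i" "p i \<le> p (Suc i)" "0 \<le> p (Suc i)"
proof -
  have le: "p j \<le> p (Suc j)" if "j < n" for j
    using assms(1) that unfolding increasing_times_def by (meson less_imp_le)
  have nonneg: "0 \<le> p j" if "j \<le> n" for j
    using that
  proof (induction j)
    case 0
    then show ?case using assms(1) by (simp add: increasing_times_def)
  next
    case (Suc j)
    with le[of j] show ?case by linarith
  qed
  show "0 \<le> p i" "p i \<le> p (Suc i)" "0 \<le> p (Suc i)"
    using le nonneg assms(2) by simp_all
qed

text \<open>By bilinearity both integrals expand into sums over pairs of intervals, and each product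
  of increments has the overlap of its intervals as its mean. The two partitions may differ.\<close>

lemma step_integral_isometry:
  assumes p: "increasing_times n p" and q: "increasing_times m q"
  shows "integrable M (\<lambda>\<omega>. step_integral W n c p \<omega> * step_integral W m d q \<omega>)"
    and "integrable lborel (\<lambda>s. step_fun n c p s * step_fun m d q s)"
    and "(\<integral>\<omega>. step_integral W n c p \<omega> * step_integral W m d q \<omega> \<partial>M)
      = (\<integral>s. step_fun n c p s * step_fun m d q s \<partial>lborel)"
proof -
  let ?w = "\<lambda>i j \<omega>. (W (p (Suc i)) \<omega> - W (p i) \<omega>) * (W (q (Suc j)) \<omega> - W (q j) \<omega>)"
  let ?v = "\<lambda>i j s. indicator {p i<..p (Suc i)} s * indicator {q j<..q (Suc j)} s :: real"
  have w: "integrable M (?w i j)" and wv: "integral\<^sup>L M (?w i j) = integral\<^sup>L lborel (?v i j)"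
    if "i < n" "j < m" for i j
    using integral_W_increments_mult[OF increasing_times_Suc(1,2)[OF p that(1)]
        increasing_times_Suc(1,2)[OF q that(2)]] .
  have v: "integrable lborel (?v i j)" for i j
  proof -
    have "emeasure lborel ({p i<..p (Suc i)} \<inter> {q j<..q (Suc j)}) \<le> emeasure lborel {p i..p (Suc i)}"
      by (intro emeasure_mono) auto
    also have "\<dots> < \<infinity>"
      using emeasure_compact_finite[OF compact_Icc] by simp
    finally have "integrable lborel (indicator ({p i<..p (Suc i)} \<inter> {q j<..q (Suc j)}) :: real \<Rightarrow> real)"
      by (intro integrable_real_indicator sets.Int) simp_all
    then show ?thesis unfolding indicator_inter_arith .
  qed
  \<comment> \<open>The common value of both sides: each of the two products is shown to have this
    double sum as its integral.\<close>
  let ?S = "\<Sum>i<n. \<Sum>j<m. (c i * d j) * integral\<^sup>L lborel (?v i j)"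
  have "has_bochner_integral M (\<lambda>\<omega>. \<Sum>i<n. \<Sum>j<m. (c i * d j) * ?w i j \<omega>) ?S"
  proof (intro has_bochner_integral_sum has_bochner_integral_mult_right)
    fix i j assume "i \<in> {..<n}" "j \<in> {..<m}"
    then have ij: "i < n" "j < m" by auto
    show "has_bochner_integral M (?w i j) (integral\<^sup>L lborel (?v i j))"
      using has_bochner_integral_integrable[OF w[OF ij]] unfolding wv[OF ij] .
  qed
  also have "(\<lambda>\<omega>. \<Sum>i<n. \<Sum>j<m. (c i * d j) * ?w i j \<omega>)
      = (\<lambda>\<omega>. step_integral W n c p \<omega> * step_integral W m d q \<omega>)"
    unfolding step_integral_def sum_product by (intro ext sum.cong refl) (simp only: mult_ac)
  finally have 1: "has_bochner_integral M
      (\<lambda>\<omega>. step_integral W n c p \<omega> * step_integral W m d q \<omega>) ?S" .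
  have "has_bochner_integral lborel (\<lambda>s. \<Sum>i<n. \<Sum>j<m. (c i * d j) * ?v i j s) ?S"
    by (intro has_bochner_integral_sum has_bochner_integral_mult_right has_bochner_integral_integrable v)
  also have "(\<lambda>s. \<Sum>i<n. \<Sum>j<m. (c i * d j) * ?v i j s)
      = (\<lambda>s. step_fun n c p s * step_fun m d q s)"
    unfolding step_fun_def sum_product by (intro ext sum.cong refl) (simp only: mult_ac)
  finally have 2: "has_bochner_integral lborel (\<lambda>s. step_fun n c p s * step_fun m d q s) ?S" .
  show "integrable M (\<lambda>\<omega>. step_integral W n c p \<omega> * step_integral W m d q \<omega>)"
    and "integrable lborel (\<lambda>s. step_fun n c p s * step_fun m d q s)"
    and "(\<integral>\<omega>. step_integral W n c p \<omega> * step_integral W m d q \<omega> \<partial>M)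
      = (\<integral>s. step_fun n c p s * step_fun m d q s \<partial>lborel)"
    using 1 2 unfolding has_bochner_integral_iff by auto
qed

section \<open>From step functions to Wiener integrals\<close>

lemma borel_measurable_step_integral:
  assumes "increasing_times n p"
  shows "step_integral W n c p \<in> borel_measurable M"
proof -
  have "(\<lambda>\<omega>. \<Sum>i<n. c i * (W (p (Suc i)) \<omega> - W (p i) \<omega>)) \<in> borel_measurable M"
    by (intro borel_measurable_sum borel_measurable_times borel_measurable_diff borel_measurable_const
        random_variable_W) (auto intro: increasing_times_Suc[OF assms])
  then show ?thesis by (simp add: step_integral_def[abs_def])
qed

lemma integral_step_integral:
  assumes "increasing_times n p"
  shows "(\<integral>\<omega>. step_integral W n c p \<omega> \<partial>M) = 0"
proof -
  have "(\<integral>\<omega>. step_integral W n c p \<omega> \<partial>M) = (\<Sum>i<n. \<integral>\<omega>. c i * (W (p (Suc i)) \<omega> - W (p i) \<omega>) \<partial>M)"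
    unfolding step_integral_def
    by (intro Bochner_Integration.integral_sum integrable_mult_right W_increment_L2(3))
      (auto intro: increasing_times_Suc[OF assms])
  also have "\<dots> = (\<Sum>i<n. 0)"
  proof (rule sum.cong[OF refl])
    fix i assume "i \<in> {..<n}"
    then have "i < n" by simp
    show "(\<integral>\<omega>. c i * (W (p (Suc i)) \<omega> - W (p i) \<omega>) \<partial>M) = 0"
      unfolding integral_mult_right_zero W_increment_L2(4)[OF increasing_times_Suc(1,3)[OF assms \<open>i < n\<close>]]
      by simp
  qed
  also have "\<dots> = 0" by simp
  finally show ?thesis .
qed

text \<open>For step functions the two inner products agree at every stage \<open>k\<close>. One
  tends to the left side and the other to the right side, so uniqueness of limits gives the
  claim.\<close>

lemma wiener_integral_isometry:
  assumes I: "has_wiener_integral M W f I" and J: "has_wiener_integral M W g J"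
  shows "(\<integral>\<omega>. I \<omega> * J \<omega> \<partial>M) = (LINT s:{0<..}|lborel. f s * g s)"
proof -
  from I obtain n c p where p: "\<And>k. increasing_times (n k) (p k)"
    and fk: "(\<lambda>k. \<integral>\<^sup>+s\<in>{0<..}. ennreal ((f s - step_fun (n k) (c k) (p k) s)\<^sup>2) \<partial>lborel) \<longlonglongrightarrow> 0"
    and Ik: "(\<lambda>k. \<integral>\<^sup>+\<omega>. ennreal ((I \<omega> - step_integral W (n k) (c k) (p k) \<omega>)\<^sup>2) \<partial>M) \<longlonglongrightarrow> 0"
    unfolding has_wiener_integral_def by blast
  from J obtain m d q where q: "\<And>k. increasing_times (m k) (q k)"
    and gk: "(\<lambda>k. \<integral>\<^sup>+s\<in>{0<..}. ennreal ((g s - step_fun (m k) (d k) (q k) s)\<^sup>2) \<partial>lborel) \<longlonglongrightarrow> 0"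
    and Jk: "(\<lambda>k. \<integral>\<^sup>+\<omega>. ennreal ((J \<omega> - step_integral W (m k) (d k) (q k) \<omega>)\<^sup>2) \<partial>M) \<longlonglongrightarrow> 0"
    unfolding has_wiener_integral_def by blast
  \<comment> \<open>All times are nonnegative, so step functions vanish for
    \<open>s \<le> 0\<close>. The distance over \<open>{0<..}\<close> is therefore a distance over
    the whole line to the function multiplied by the indicator of \<open>{0<..}\<close>.\<close>
  have step0: "step_fun N e r s = 0" if "increasing_times N r" "s \<le> 0" for N e r s
  proof -
    have "indicator {r i<..r (Suc i)} s = (0::real)" if "i < N" for i
      using increasing_times_Suc(1)[OF \<open>increasing_times N r\<close> that] \<open>s \<le> 0\<close> by simp
    then show ?thesis by (simp add: step_fun_def)
  qed
  have cut: "(\<integral>\<^sup>+s\<in>{0<..}. ennreal ((h s - step_fun N e r s)\<^sup>2) \<partial>lborel)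
      = (\<integral>\<^sup>+s. ennreal ((indicator {0<..} s * h s - step_fun N e r s)\<^sup>2) \<partial>lborel)"
    if "increasing_times N r" for h N e r
    by (intro nn_integral_cong) (auto simp: indicator_def step0[OF that])
  have sq: "(\<lambda>s. (indicator {0<..} s * h s)\<^sup>2) = (\<lambda>s. indicator {0<..} s *\<^sub>R (h s)\<^sup>2)" for h :: "real \<Rightarrow> real"
    by (auto simp: indicator_def)
  have meas: "step_fun N e r \<in> borel_measurable lborel" for N e r
    unfolding step_fun_def[abs_def] by measurable
  have step2: "integrable lborel (\<lambda>s. (step_fun N e r s)\<^sup>2)"
    "integrable M (\<lambda>\<omega>. (step_integral W N e r \<omega>)\<^sup>2)"
    if "increasing_times N r" for N e r
    using step_integral_isometry(1,2)[OF that that] unfolding power2_eq_square by blast+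
  have L2: "(\<lambda>s. indicator {0<..} s * h s) \<in> borel_measurable lborel"
    "integrable lborel (\<lambda>s. (indicator {0<..} s * h s)\<^sup>2)"
    "Z \<in> borel_measurable M" "integrable M (\<lambda>\<omega>. (Z \<omega>)\<^sup>2)"
    if "has_wiener_integral M W h Z" for h Z
    using that unfolding has_wiener_integral_def set_borel_measurable_def set_integrable_def sq
      real_scaleR_def by blast+
  note cut_lim = fk[unfolded cut[OF p]] gk[unfolded cut[OF q]]
  have "(\<lambda>k. \<integral>s. step_fun (n k) (c k) (p k) s * step_fun (m k) (d k) (q k) s \<partial>lborel)
      \<longlonglongrightarrow> (\<integral>s. (indicator {0<..} s * f s) * (indicator {0<..} s * g s) \<partial>lborel)"
    by (rule L2_tendsto_integral_mult[OF L2(1)[OF I] L2(1)[OF J] meas meas L2(2)[OF I] L2(2)[OF J]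
          step2(1)[OF p] step2(1)[OF q] cut_lim])
  moreover have "(\<lambda>k. \<integral>\<omega>. step_integral W (n k) (c k) (p k) \<omega> * step_integral W (m k) (d k) (q k) \<omega> \<partial>M)
      \<longlonglongrightarrow> (\<integral>\<omega>. I \<omega> * J \<omega> \<partial>M)"
    by (rule L2_tendsto_integral_mult[OF L2(3)[OF I] L2(3)[OF J] borel_measurable_step_integral[OF p]
          borel_measurable_step_integral[OF q] L2(4)[OF I] L2(4)[OF J] step2(2)[OF p] step2(2)[OF q] Ik Jk])
  ultimately have "(\<integral>\<omega>. I \<omega> * J \<omega> \<partial>M) = (\<integral>s. (indicator {0<..} s * f s) * (indicator {0<..} s * g s) \<partial>lborel)"
    unfolding step_integral_isometry(3)[OF p q] by (rule LIMSEQ_unique[rotated])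
  also have "\<dots> = (LINT s:{0<..}|lborel. f s * g s)"
    unfolding set_lebesgue_integral_def
    by (intro Bochner_Integration.integral_cong) (auto simp: indicator_def)
  finally show ?thesis .
qed

lemma wiener_integral_expectation:
  assumes I: "has_wiener_integral M W f I"
  shows "(\<integral>\<omega>. I \<omega> \<partial>M) = 0"
proof -
  from I obtain n c p where p: "\<And>k. increasing_times (n k) (p k)"
    and "(\<lambda>k. \<integral>\<^sup>+s\<in>{0<..}. ennreal ((f s - step_fun (n k) (c k) (p k) s)\<^sup>2) \<partial>lborel) \<longlonglongrightarrow> 0"
    and Ik: "(\<lambda>k. \<integral>\<^sup>+\<omega>. ennreal ((I \<omega> - step_integral W (n k) (c k) (p k) \<omega>)\<^sup>2) \<partial>M) \<longlonglongrightarrow> 0"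
    unfolding has_wiener_integral_def by blast
  \<comment> \<open>The expectation is the inner product with the constant 1, which is square
    integrable on a probability space. The means thus converge along with the step
    integrals.\<close>
  have "(\<lambda>k. \<integral>\<omega>. step_integral W (n k) (c k) (p k) \<omega> * 1 \<partial>M) \<longlonglongrightarrow> (\<integral>\<omega>. I \<omega> * 1 \<partial>M)"
  proof (rule L2_tendsto_integral_mult[OF _ _ borel_measurable_step_integral[OF p] _ _ _ _ _ Ik])
    show "integrable M (\<lambda>\<omega>. (step_integral W (n k) (c k) (p k) \<omega>)\<^sup>2)" for k
      using step_integral_isometry(1)[OF p p] unfolding power2_eq_square .
  qed (use I in \<open>simp_all add: has_wiener_integral_def\<close>)
  then show ?thesis
    using LIMSEQ_unique[OF tendsto_const[of 0]] by (simp add: integral_step_integral[OF p])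
qed

end

section \<open>The Volterra kernel\<close>

text \<open>For a nonnegative function a gauge integral bounds the Lebesgue integral. This makes the
  known gauge integrals of powers available for Lebesgue integrability.\<close>

lemma set_integrable_lborel_of_has_integral:
  fixes f :: "real \<Rightarrow> real"
  assumes [measurable]: "f \<in> borel_measurable borel" "A \<in> sets borel"
    and "\<And>x. x \<in> A \<Longrightarrow> 0 \<le> f x" "(f has_integral I) A"
  shows "set_integrable lborel A f"
  unfolding set_integrable_def
proof (rule integrableI_nonneg)
  show "AE x in lborel. 0 \<le> indicator A x *\<^sub>R f x"
    using assms(3) by (auto simp: indicator_def)
  show "(\<integral>\<^sup>+x. ennreal (indicator A x *\<^sub>R f x) \<partial>lborel) < \<infinity>"
    using nn_integral_has_integral_lebesgue[OF assms(3,4)] by simp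
qed measurable

lemma set_integrable_powr_Ioi:
  fixes a e :: real
  assumes "e < - 1" "0 < a"
  shows "set_integrable lborel {a..} (\<lambda>x. x powr e)"
  by (rule set_integrable_lborel_of_has_integral[OF _ _ _ has_integral_powr_to_inf[OF assms]]) auto

lemma set_integrable_powr_shift:
  fixes \<gamma> s t :: real
  assumes "\<gamma> > - 1"
  shows "set_integrable lborel {s<..<t} (\<lambda>u. (u - s) powr \<gamma>)"
proof (cases "s < t")
  case True
  have "set_integrable lborel {0..t - s} (\<lambda>x. x powr \<gamma>)"
    by (rule set_integrable_lborel_of_has_integral[OF _ _ _ has_integral_powr_from_0]) (use assms True in auto)
  then have "set_integrable lborel {0<..<t - s} (\<lambda>x. x powr \<gamma>)"
    by (rule set_integrable_subset) auto
  \<comment> \<open>Translation by \<open>s\<close>, written as an affine substitution with slope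
    1.\<close>
  then have "integrable lborel (\<lambda>u. indicator {0<..<t - s} (- s + 1 * u) *\<^sub>R (- s + 1 * u) powr \<gamma>)"
    unfolding set_integrable_def by (rule lborel_integrable_real_affine) simp
  also have "(\<lambda>u. indicator {0<..<t - s} (- s + 1 * u) *\<^sub>R (- s + 1 * u) powr \<gamma>)
      = (\<lambda>u. indicator {s<..<t} u *\<^sub>R (u - s) powr \<gamma>)"
    by (auto simp: indicator_def fun_eq_iff)
  finally show ?thesis
    unfolding set_integrable_def .
qed (simp add: set_integrable_def)

text \<open>The hypotheses place \<open>x\<close> in the interval from \<rho> to
  \<open>1 / \<rho>\<close>. Inversion maps this interval to itself, which reduces negative
  exponents to nonnegative ones.\<close>

lemma powr_bounds:
  fixes \<rho> x a :: real
  assumes "0 < \<rho>" "\<rho> \<le> 1" "\<rho> \<le> x" "x * \<rho> \<le> 1"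
  shows "\<rho> powr \<bar>a\<bar> \<le> x powr a" "x powr a \<le> 1 / \<rho> powr \<bar>a\<bar>"
proof -
  have *: "\<rho> powr b \<le> y powr b \<and> y powr b \<le> 1 / \<rho> powr b"
    if "0 \<le> b" "\<rho> \<le> y" "y * \<rho> \<le> 1" for b y
  proof
    show "\<rho> powr b \<le> y powr b"
      using assms(1) that by (intro powr_mono2) auto
    have "(y * \<rho>) powr b \<le> 1"
      using assms(1) that powr_mono2[of b "y * \<rho>" 1] by simp
    then show "y powr b \<le> 1 / \<rho> powr b"
      using assms(1) that by (simp add: powr_mult field_simps)
  qed
  have "\<rho> powr \<bar>a\<bar> \<le> x powr a \<and> x powr a \<le> 1 / \<rho> powr \<bar>a\<bar>"
  proof (cases "0 \<le> a")
    case True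
    with *[of a x] assms show ?thesis by simp
  next
    case False
    have "x powr a = (1 / x) powr (- a)"
      using assms by (simp add: powr_divide powr_minus_divide)
    moreover have "\<rho> \<le> 1 / x" "1 / x * \<rho> \<le> 1"
      using assms by (auto simp: field_simps)
    ultimately show ?thesis using *[of "- a" "1 / x"] False by simp
  qed
  then show "\<rho> powr \<bar>a\<bar> \<le> x powr a" "x powr a \<le> 1 / \<rho> powr \<bar>a\<bar>" by auto
qed

text \<open>As \<open>s > 0\<close>, the factor \<open>u powr \<beta>\<close> is bounded by its
  larger endpoint value. The only possible singularity is at \<open>u = s\<close>, and it is
  integrable because \<open>\<gamma> > - 1\<close>.\<close>

lemma set_integrable_volterra_integrand:
  fixes \<beta> \<gamma> s t :: real
  assumes "\<gamma> > - 1" "0 < s"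
  shows "set_integrable lborel {s<..<t} (\<lambda>u. u powr \<beta> * (u - s) powr \<gamma>)"
proof (rule set_integrable_bound)
  show "set_integrable lborel {s<..<t} (\<lambda>u. max (s powr \<beta>) (t powr \<beta>) * (u - s) powr \<gamma>)"
    using set_integrable_powr_shift[OF assms(1)] by (rule set_integrable_mult_right)
  show "set_borel_measurable lborel {s<..<t} (\<lambda>u. u powr \<beta> * (u - s) powr \<gamma>)"
    unfolding set_borel_measurable_def by measurable
  have "u powr \<beta> \<le> max (s powr \<beta>) (t powr \<beta>)" if "s < u" "u < t" for u
  proof (cases "0 \<le> \<beta>")
    case True
    then have "u powr \<beta> \<le> t powr \<beta>" using that assms by (intro powr_mono2) auto
    then show ?thesis by simp
  next
    case False
    then have "u powr \<beta> \<le> s powr \<beta>" using that assms by (intro powr_mono2') auto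
    then show ?thesis by simp
  qed
  then show "AE u in lborel. u \<in> {s<..<t} \<longrightarrow> norm (u powr \<beta> * (u - s) powr \<gamma>)
      \<le> norm (max (s powr \<beta>) (t powr \<beta>) * (u - s) powr \<gamma>)"
    by (auto simp: abs_mult intro!: mult_right_mono abs_ge_self[THEN order.trans[rotated]])
qed

section \<open>Sign, monotonicity and increments of the kernel\<close>

lemma volterra_kernel_nonneg: "0 \<le> volterra_kernel \<alpha> \<beta> \<gamma> t s"
  unfolding volterra_kernel_def set_lebesgue_integral_def
  by (auto intro!: mult_nonneg_nonneg integral_nonneg_AE)

lemma volterra_kernel_mono:
  assumes "\<gamma> > - 1" "t \<le> t'"
  shows "volterra_kernel \<alpha> \<beta> \<gamma> t s \<le> volterra_kernel \<alpha> \<beta> \<gamma> t' s"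
proof (cases "0 < s \<and> s < t")
  case True
  have "(LINT u:{s<..<t}|lborel. u powr \<beta> * (u - s) powr \<gamma>)
      \<le> (LINT u:{s<..<t'}|lborel. u powr \<beta> * (u - s) powr \<gamma>)"
    unfolding set_lebesgue_integral_def
    using set_integrable_volterra_integrand[OF assms(1), of s] True assms(2)
    by (intro integral_mono) (auto simp: set_integrable_def indicator_def)
  with True assms(2) show ?thesis
    by (auto simp: volterra_kernel_def intro: mult_left_mono)
next
  case False
  then show ?thesis
    using volterra_kernel_nonneg[of \<alpha> \<beta> \<gamma> t' s] by (auto simp: volterra_kernel_def[of _ _ _ t])
qed

text \<open>For \<open>u\<close> between \<open>t\<close> and \<open>t + 1\<close>, both
  \<open>u\<close> and \<open>u - s\<close> lie between \<open>t - 1\<close> and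
  \<open>t + 1\<close>. After division by \<open>t\<close> they fall under
  \<open>powr_bounds\<close> with \<open>\<rho> = 1 - 1 / t\<close>. The factor \<open>r\<close>
  does not depend on \<open>s\<close>, so the bounds can later be integrated over
  \<open>s\<close>.\<close>

lemma volterra_kernel_increment_bounds:
  fixes \<alpha> \<beta> \<gamma> s t :: real
  assumes "\<gamma> > - 1" "0 < s" "s < 1" "1 < t"
  defines "r \<equiv> (1 - 1 / t) powr (\<bar>\<beta>\<bar> + \<bar>\<gamma>\<bar>)"
  shows "r * t powr (\<beta> + \<gamma>) * s powr \<alpha>
      \<le> volterra_kernel \<alpha> \<beta> \<gamma> (t + 1) s - volterra_kernel \<alpha> \<beta> \<gamma> t s" (is "?L \<le> ?D")
    and "volterra_kernel \<alpha> \<beta> \<gamma> (t + 1) s - volterra_kernel \<alpha> \<beta> \<gamma> t s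
      \<le> t powr (\<beta> + \<gamma>) / r * s powr \<alpha>" (is "_ \<le> ?U")
proof -
  let ?h = "\<lambda>u. u powr \<beta> * (u - s) powr \<gamma>"
  have int: "set_integrable lborel {s<..<t'} ?h" for t'
    using assms by (intro set_integrable_volterra_integrand)
  have int': "set_integrable lborel {t..<t + 1} ?h"
    by (rule set_integrable_subset[OF int[of "t + 1"]]) (use assms in auto)
  \<comment> \<open>Since \<open>s < 1 < t\<close>, both kernels contain the integral over
    \<open>{s<..<t}\<close>, which cancels from the increment.\<close>
  have "{s<..<t + 1} = {s<..<t} \<union> {t..<t + 1}"
    using assms by auto
  then have "(LINT u:{s<..<t + 1}|lborel. ?h u)
      = (LINT u:{s<..<t}|lborel. ?h u) + (LINT u:{t..<t + 1}|lborel. ?h u)"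
    using set_integral_Un[OF _ int[of t] int'] by force
  then have D: "?D = s powr \<alpha> * (LINT u:{t..<t + 1}|lborel. ?h u)"
    using assms by (simp add: volterra_kernel_def algebra_simps)
  have const: "set_integrable lborel {t..<t + 1} (\<lambda>u. c)"
    "(LINT u:{t..<t + 1}|lborel. c) = c" for c :: real
    by (auto simp: set_integrable_def set_lebesgue_integral_def)
  have bounds: "r * t powr (\<beta> + \<gamma>) \<le> ?h u \<and> ?h u \<le> t powr (\<beta> + \<gamma>) / r"
    if "u \<in> {t..<t + 1}" for u
  proof -
    define \<rho> where "\<rho> = 1 - 1 / t"
    have \<rho>: "0 < \<rho>" "\<rho> \<le> 1" using assms by (auto simp: \<rho>_def)
    \<comment> \<open>The product is \<open>1 - 1 / t^2\<close>, so the upper estimate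
      \<open>1 + 1 / t\<close> is at most \<open>1 / \<rho>\<close>.\<close>
    have "(1 + 1 / t) * \<rho> \<le> 1"
      by (simp add: \<rho>_def algebra_simps)
    moreover have le: "x / t \<le> 1 + 1 / t" if "x \<le> t + 1" for x
      using divide_right_mono[OF that, of t] assms by (simp add: add_divide_distrib)
    ultimately have up: "x / t * \<rho> \<le> 1" if "x \<le> t + 1" for x
      using mult_right_mono[OF le[OF that], of \<rho>] \<rho> by linarith
    have low: "\<rho> \<le> x / t" if "t - 1 \<le> x" for x
      using divide_right_mono[OF that, of t] assms by (simp add: \<rho>_def diff_divide_distrib)
    have pos: "0 < t" "0 < u" "0 < u - s" using that assms by auto
    have "?h u = t powr (\<beta> + \<gamma>) * ((u / t) powr \<beta> * ((u - s) / t) powr \<gamma>)"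
      using pos by (simp add: powr_divide powr_add)
    moreover have "r = \<rho> powr \<bar>\<beta>\<bar> * \<rho> powr \<bar>\<gamma>\<bar>"
      by (simp add: r_def \<rho>_def powr_add)
    moreover have "\<rho> powr \<bar>\<beta>\<bar> * \<rho> powr \<bar>\<gamma>\<bar> \<le> (u / t) powr \<beta> * ((u - s) / t) powr \<gamma>"
      using that assms by (intro mult_mono powr_bounds[OF \<rho>] low up) auto
    moreover have "(u / t) powr \<beta> * ((u - s) / t) powr \<gamma> \<le> (1 / \<rho> powr \<bar>\<beta>\<bar>) * (1 / \<rho> powr \<bar>\<gamma>\<bar>)"
      using that assms \<rho> by (intro mult_mono powr_bounds[OF \<rho>] low up) auto
    ultimately show ?thesis
      using mult_left_mono[of r "(u / t) powr \<beta> * ((u - s) / t) powr \<gamma>" "t powr (\<beta> + \<gamma>)"]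
        mult_left_mono[of "(u / t) powr \<beta> * ((u - s) / t) powr \<gamma>" "1 / r" "t powr (\<beta> + \<gamma>)"]
      by (simp add: mult.commute)
  qed
  have "r * t powr (\<beta> + \<gamma>) \<le> (LINT u:{t..<t + 1}|lborel. ?h u)"
    using set_integral_mono[OF const(1)[of "r * t powr (\<beta> + \<gamma>)"] int'] bounds by (simp add: const(2))
  then show "?L \<le> ?D"
    unfolding D mult.commute[of _ "s powr \<alpha>"] by (intro mult_left_mono) auto
  have "(LINT u:{t..<t + 1}|lborel. ?h u) \<le> t powr (\<beta> + \<gamma>) / r"
    using set_integral_mono[OF int' const(1)[of "t powr (\<beta> + \<gamma>) / r"]] bounds by (simp add: const(2))
  then show "?D \<le> ?U"
    unfolding D mult.commute[of _ "s powr \<alpha>"] by (intro mult_left_mono) auto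
qed

section \<open>The constant as a Beta integral\<close>

lemma Beta_real_pos: "0 < a \<Longrightarrow> 0 < b \<Longrightarrow> 0 < Beta a (b::real)"
  by (simp add: Beta_def)

text \<open>The substitution \<open>s = u * y\<close> extracts \<open>u powr (a + b)\<close> from
  the integrand and a further factor \<open>u\<close> from the measure. The integral is an extended
  nonnegative one, ready for use after Tonelli's theorem.\<close>

lemma nn_integral_Beta_scaled:
  fixes a b u :: real
  assumes "a > - 1" "b > - 1" "0 < u"
  shows "(\<integral>\<^sup>+s. ennreal (s powr a * (u - s) powr b * indicator {0<..<u} s) \<partial>lborel)
    = ennreal (u powr (a + b + 1) * Beta (a + 1) (b + 1))"
proof -
  have beta: "(\<integral>\<^sup>+y. ennreal (y powr a * (1 - y) powr b) * indicator {0..1} y \<partial>lborel)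
      = ennreal (Beta (a + 1) (b + 1))"
    using has_integral_Beta_real[of "a + 1" "b + 1"] assms
    by (intro nn_integral_has_integral_lebesgue') auto
  have "(\<integral>\<^sup>+s. ennreal (s powr a * (u - s) powr b * indicator {0<..<u} s) \<partial>lborel)
      = ennreal \<bar>u\<bar> * (\<integral>\<^sup>+y. ennreal ((0 + u * y) powr a * (u - (0 + u * y)) powr b
          * indicator {0<..<u} (0 + u * y)) \<partial>lborel)"
    using assms by (intro nn_integral_real_affine) auto
  also have "(\<integral>\<^sup>+y. ennreal ((0 + u * y) powr a * (u - (0 + u * y)) powr b
          * indicator {0<..<u} (0 + u * y)) \<partial>lborel)
      = (\<integral>\<^sup>+y. ennreal (u powr (a + b)) * (ennreal (y powr a * (1 - y) powr b) * indicator {0..1} y) \<partial>lborel)"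
  proof (intro nn_integral_cong)
    fix y :: real
    consider "0 < y" "y < 1" | "y \<le> 0 \<or> y \<ge> 1" by linarith
    then show "ennreal ((0 + u * y) powr a * (u - (0 + u * y)) powr b * indicator {0<..<u} (0 + u * y))
        = ennreal (u powr (a + b)) * (ennreal (y powr a * (1 - y) powr b) * indicator {0..1} y)"
    proof cases
      case 1
      have "u - u * y = u * (1 - y)" by (simp add: algebra_simps)
      then have "(u * y) powr a * (u - u * y) powr b = u powr (a + b) * (y powr a * (1 - y) powr b)"
        using 1 assms by (simp add: powr_mult powr_add)
      then show ?thesis
        using 1 assms by (simp add: ennreal_mult)
    next
      case 2
      then have "\<not> (0 < u * y \<and> u * y < u)"
        using assms by (auto simp: zero_less_mult_iff)
      \<comment> \<open>At the endpoints one factor is a power of 0, and \<open>0 powr a = 0\<close>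
        for every exponent. Passing from the open to the closed interval thus changes
        nothing.\<close>
      moreover have "y powr a * (1 - y) powr b * indicator {0..1} y = 0"
        using 2 by (cases "y = 0 \<or> y = 1") (auto simp: indicator_def)
      ultimately show ?thesis by (auto simp: indicator_def)
    qed
  qed
  also have "\<dots> = ennreal (u powr (a + b)) * ennreal (Beta (a + 1) (b + 1))"
    unfolding beta[symmetric] by (rule nn_integral_cmult) measurable
  also have "ennreal \<bar>u\<bar> * \<dots> = ennreal (u powr (a + b + 1) * Beta (a + 1) (b + 1))"
    using assms Beta_real_pos[of "a + 1" "b + 1"] by (simp add: powr_add mult_ac flip: ennreal_mult')
  finally show ?thesis .
qed

text \<open>Interchanging the order of integration turns the inner integral into a Beta integral.\<close>

lemma nn_integral_powr_volterra_kernel: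
  fixes \<alpha> \<beta> \<gamma> :: real
  assumes "\<alpha> > - 1 / 2" "\<gamma> > - 1" "\<alpha> + \<beta> + \<gamma> > - 3 / 2"
  shows "(\<integral>\<^sup>+s. ennreal (s powr \<alpha> * volterra_kernel \<alpha> \<beta> \<gamma> 1 s) \<partial>lborel)
    = ennreal (Beta (2 * \<alpha> + 1) (\<gamma> + 1) / (2 * \<alpha> + \<beta> + \<gamma> + 2))"
proof -
  let ?B = "Beta (2 * \<alpha> + 1) (\<gamma> + 1)"
  \<comment> \<open>The exponent \<open>2 * \<alpha>\<close> collects the outer weight
    \<open>s powr \<alpha>\<close> and the same factor inside the kernel. The indicators encode the
    triangle \<open>0 < s < u < 1\<close>, so that both iterated integrals run over the whole
    line.\<close>
  let ?g = "\<lambda>s u. s powr (2 * \<alpha>) * (u - s) powr \<gamma> * indicator {0<..<u} s * (u powr \<beta> * indicator {0<..<1} u)"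
  have B: "0 < ?B" using assms by (intro Beta_real_pos) auto
  have "(\<integral>\<^sup>+s. ennreal (s powr \<alpha> * volterra_kernel \<alpha> \<beta> \<gamma> 1 s) \<partial>lborel)
      = (\<integral>\<^sup>+s. \<integral>\<^sup>+u. ennreal (?g s u) \<partial>lborel \<partial>lborel)"
  proof (intro nn_integral_cong)
    fix s :: real
    show "ennreal (s powr \<alpha> * volterra_kernel \<alpha> \<beta> \<gamma> 1 s) = (\<integral>\<^sup>+u. ennreal (?g s u) \<partial>lborel)"
    proof (cases "0 < s \<and> s < 1")
      case True
      have "(\<integral>\<^sup>+u. ennreal (?g s u) \<partial>lborel) = (\<integral>\<^sup>+u. ennreal (s powr (2 * \<alpha>) *
          (indicator {s<..<1} u *\<^sub>R (u powr \<beta> * (u - s) powr \<gamma>))) \<partial>lborel)"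
        using True by (intro nn_integral_cong) (auto simp: indicator_def)
      also have "\<dots> = ennreal (\<integral>u. s powr (2 * \<alpha>) *
          (indicator {s<..<1} u *\<^sub>R (u powr \<beta> * (u - s) powr \<gamma>)) \<partial>lborel)"
        using set_integrable_volterra_integrand[of \<gamma> s 1 \<beta>] True assms
        by (intro nn_integral_eq_integral integrable_mult_right) (auto simp: set_integrable_def)
      also have "\<dots> = ennreal (s powr \<alpha> * volterra_kernel \<alpha> \<beta> \<gamma> 1 s)"
        using True powr_add[of s \<alpha> \<alpha>]
        by (simp add: volterra_kernel_def set_lebesgue_integral_def del: indicator_simps)
      finally show ?thesis by simp
    next
      case False
      then have "(\<lambda>u. ennreal (?g s u)) = (\<lambda>_. 0)" by (auto simp: indicator_def fun_eq_iff)
      then show ?thesis using False by (simp only:) (auto simp: volterra_kernel_def)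
    qed
  qed
  also have "\<dots> = (\<integral>\<^sup>+u. \<integral>\<^sup>+s. ennreal (?g s u) \<partial>lborel \<partial>lborel)"
    by (rule lborel_pair.Fubini') (simp add: indicator_def split_beta')
  also have "\<dots> = (\<integral>\<^sup>+u. ennreal ?B * (ennreal (u powr (2 * \<alpha> + \<beta> + \<gamma> + 1)) * indicator {0..1} u) \<partial>lborel)"
  proof (rule nn_integral_cong_AE)
    have "(\<integral>\<^sup>+s. ennreal (?g s u) \<partial>lborel)
        = ennreal ?B * (ennreal (u powr (2 * \<alpha> + \<beta> + \<gamma> + 1)) * indicator {0..1} u)"
      if "u \<noteq> 0" "u \<noteq> 1" for u
    proof (cases "0 < u \<and> u < 1")
      case True
      have "(\<integral>\<^sup>+s. ennreal (?g s u) \<partial>lborel)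
          = (\<integral>\<^sup>+s. ennreal (s powr (2 * \<alpha>) * (u - s) powr \<gamma> * indicator {0<..<u} s) * ennreal (u powr \<beta>) \<partial>lborel)"
        using True by (intro nn_integral_cong) (simp add: ennreal_mult')
      also have "\<dots> = ennreal (u powr (2 * \<alpha> + \<gamma> + 1) * ?B) * ennreal (u powr \<beta>)"
        using nn_integral_Beta_scaled[of "2 * \<alpha>" \<gamma> u] True assms
        by (subst nn_integral_multc) (auto simp: add_ac)
      also have "\<dots> = ennreal (?B * u powr (2 * \<alpha> + \<beta> + \<gamma> + 1))"
        using B by (simp add: powr_add mult_ac flip: ennreal_mult')
      finally show ?thesis using True B by (simp add: ennreal_mult)
    next
      case False
      with that have "(\<lambda>s. ennreal (?g s u)) = (\<lambda>_. 0)" by (auto simp: indicator_def fun_eq_iff)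
      then show ?thesis using False that by (simp only:) (auto simp: indicator_def)
    qed
    \<comment> \<open>At \<open>u = 1\<close> the two sides differ, because one indicator belongs to
      an open interval and the other to a closed one.\<close>
    moreover have "AE u in lborel. u \<noteq> (0::real) \<and> u \<noteq> 1"
      by (intro AE_conjI AE_lborel_singleton)
    ultimately show "AE u in lborel. (\<integral>\<^sup>+s. ennreal (?g s u) \<partial>lborel)
        = ennreal ?B * (ennreal (u powr (2 * \<alpha> + \<beta> + \<gamma> + 1)) * indicator {0..1} u)"
      by (auto elim: eventually_mono)
  qed
  also have "\<dots> = ennreal ?B * (\<integral>\<^sup>+u. ennreal (u powr (2 * \<alpha> + \<beta> + \<gamma> + 1)) * indicator {0..1} u \<partial>lborel)"
    by (rule nn_integral_cmult) measurable
  also have "(\<integral>\<^sup>+u. ennreal (u powr (2 * \<alpha> + \<beta> + \<gamma> + 1)) * indicator {0..1} u \<partial>lborel)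
      = ennreal (1 / (2 * \<alpha> + \<beta> + \<gamma> + 2))"
  proof (rule nn_integral_has_integral_lebesgue')
    \<comment> \<open>The bounds on \<alpha> and on \<open>\<alpha> + \<beta> + \<gamma>\<close> add
      up to \<open>2 * \<alpha> + \<beta> + \<gamma> + 2 > 0\<close>, so the exponent exceeds
      -1.\<close>
    show "((\<lambda>u. u powr (2 * \<alpha> + \<beta> + \<gamma> + 1)) has_integral 1 / (2 * \<alpha> + \<beta> + \<gamma> + 2)) {0..1}"
      using has_integral_powr_from_0[of "2 * \<alpha> + \<beta> + \<gamma> + 1" 1] assms by (simp add: add_ac)
  qed simp
  also have "ennreal ?B * ennreal (1 / (2 * \<alpha> + \<beta> + \<gamma> + 2)) = ennreal (?B / (2 * \<alpha> + \<beta> + \<gamma> + 2))"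
    using B by (simp flip: ennreal_mult')
  finally show ?thesis .
qed

section \<open>Functions with power decay\<close>

text \<open>A monotone function is Borel, and on \<open>{0..b}\<close> its unit increments are at
  most the total increase from 0 to \<open>b + 1\<close>. This settles the regularity of the
  covariance in \<open>t\<close>.\<close>

lemma mono_increment_measurable_integrable:
  fixes R :: "real \<Rightarrow> real"
  assumes R: "mono_on {0..} R" and D: "\<And>t. 0 \<le> t \<Longrightarrow> D t = R (t + 1) - R t"
    and A: "A \<in> sets borel" "A \<subseteq> {0..}"
  shows "set_borel_measurable lborel A D"
    and "A \<subseteq> {0..b} \<Longrightarrow> set_integrable lborel A D"
proof -
  \<comment> \<open>Constant continuation to the left of 0 makes the function monotone on the whole
    line.\<close>
  define R' where "R' = (\<lambda>t. R (max 0 t))"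
  have "mono R'"
    using R by (auto simp: R'_def mono_def mono_on_def)
  then have [measurable]: "R' \<in> borel_measurable borel"
    by (rule borel_measurable_mono)
  note [measurable] = A(1)
  have eq: "(\<lambda>t. indicator A t *\<^sub>R D t) = (\<lambda>t. indicator A t *\<^sub>R (R' (t + 1) - R' t))"
    using A(2) by (force simp: fun_eq_iff indicator_def D R'_def)
  show "set_borel_measurable lborel A D"
    unfolding set_borel_measurable_def eq by measurable
  show "set_integrable lborel A D" if b: "A \<subseteq> {0..b}"
    unfolding set_integrable_def eq
  proof (rule Bochner_Integration.integrable_bound)
    show "integrable lborel (\<lambda>t. indicator {0..b} t *\<^sub>R (R' (b + 1) - R' 0))"
      by (intro integrable_scaleR_left integrable_real_indicator) (auto simp: emeasure_lborel_Icc_eq)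
    have "norm (indicator A t *\<^sub>R (R' (t + 1) - R' t)) \<le> norm (indicator {0..b} t *\<^sub>R (R' (b + 1) - R' 0))" for t
    proof (cases "t \<in> A")
      case True
      then have t: "0 \<le> t" "t \<le> b" using b by auto
      have "R' 0 \<le> R' t" "R' t \<le> R' (t + 1)" "R' (t + 1) \<le> R' (b + 1)"
        using \<open>mono R'\<close> t by (auto elim: monoD)
      with True t show ?thesis by simp
    qed simp
    then show "AE t in lborel. norm (indicator A t *\<^sub>R (R' (t + 1) - R' t))
        \<le> norm (indicator {0..b} t *\<^sub>R (R' (b + 1) - R' 0))"
      by simp
  qed measurable
qed

text \<open>Division by \<open>C * t powr p\<close> squeezes the quotient between
  \<open>(1 - 1 / t) powr q\<close> and its reciprocal, both of which tend to 1.\<close>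

lemma asymp_equiv_powr_sandwich:
  fixes D :: "real \<Rightarrow> real" and C p q :: real
  assumes C: "0 < C"
    and lower: "\<And>t. 1 < t \<Longrightarrow> (1 - 1 / t) powr q * t powr p * C \<le> D t"
    and upper: "\<And>t. 1 < t \<Longrightarrow> D t \<le> t powr p / (1 - 1 / t) powr q * C"
  shows "D \<sim>[at_top] (\<lambda>t. C * t powr p)"
proof (rule asymp_equivI')
  have "((\<lambda>t::real. 1 - inverse t) \<longlongrightarrow> 1 - 0) at_top"
    by (intro tendsto_intros tendsto_inverse_0_at_top filterlim_ident)
  then have "((\<lambda>t::real. (1 - 1 / t) powr q) \<longlongrightarrow> 1 powr q) at_top"
    by (intro tendsto_powr tendsto_const) (simp_all add: inverse_eq_divide)
  then have r: "((\<lambda>t::real. (1 - 1 / t) powr q) \<longlongrightarrow> 1) at_top"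
    by simp
  have r': "((\<lambda>t::real. 1 / (1 - 1 / t) powr q) \<longlongrightarrow> 1) at_top"
    using tendsto_divide[OF tendsto_const[of 1] r] by simp
  have ev: "\<forall>\<^sub>F t :: real in at_top. 1 < t" by (rule eventually_gt_at_top)
  show "((\<lambda>t. D t / (C * t powr p)) \<longlongrightarrow> 1) at_top"
  proof (rule tendsto_sandwich[OF _ _ r r'])
    show "\<forall>\<^sub>F t in at_top. (1 - 1 / t) powr q \<le> D t / (C * t powr p)"
      using ev
    proof eventually_elim
      case (elim t)
      then have "0 < C * t powr p" using C by simp
      with lower[OF elim] show ?case by (simp add: pos_le_divide_eq mult_ac)
    qed
    show "\<forall>\<^sub>F t in at_top. D t / (C * t powr p) \<le> 1 / (1 - 1 / t) powr q"
      using ev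
    proof eventually_elim
      case (elim t)
      then have "0 < C * t powr p" using C by simp
      with upper[OF elim] show ?case by (simp add: pos_divide_le_eq mult_ac)
    qed
  qed
qed

text \<open>The quotient tends to 1 and is therefore eventually between \<open>1 / 2\<close> and 2.
  The threshold is raised to at least 1 to stay away from the behaviour of powers and logarithms at
  0.\<close>

lemma asymp_equiv_powr_bounds:
  fixes D :: "real \<Rightarrow> real" and C p :: real
  assumes C: "0 < C" and D: "D \<sim>[at_top] (\<lambda>t. C * t powr p)"
  obtains T where "1 \<le> T" "\<And>t. T \<le> t \<Longrightarrow> C / 2 * t powr p \<le> D t"
    "\<And>t. T \<le> t \<Longrightarrow> D t \<le> 2 * C * t powr p"
proof -
  have "\<forall>\<^sub>F t in at_top. D t \<noteq> 0 \<or> C * t powr p \<noteq> 0"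
    using eventually_gt_at_top[of 0] by eventually_elim (use C in simp)
  \<comment> \<open>Asymptotic equivalence counts \<open>0 / 0\<close> as 1. The comparison function
    is nonzero for \<open>t > 0\<close>, so the plain quotient converges as well.\<close>
  from asymp_equivD_strong[OF D this] have lim: "((\<lambda>t. D t / (C * t powr p)) \<longlongrightarrow> 1) at_top" .
  have "\<forall>\<^sub>F t in at_top. 1 / 2 < D t / (C * t powr p)" "\<forall>\<^sub>F t in at_top. D t / (C * t powr p) < 2"
    using order_tendstoD[OF lim, of "1 / 2"] order_tendstoD[OF lim, of 2] by auto
  then have "\<forall>\<^sub>F t in at_top. C / 2 * t powr p \<le> D t \<and> D t \<le> 2 * C * t powr p"
    using eventually_gt_at_top[of 0]
  proof eventually_elim
    case (elim t)
    then have "0 < C * t powr p" using C by simp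
    with elim show ?case by (simp add: pos_less_divide_eq pos_divide_less_eq)
  qed
  then obtain T where "\<And>t. T \<le> t \<Longrightarrow> C / 2 * t powr p \<le> D t \<and> D t \<le> 2 * C * t powr p"
    by (auto simp: eventually_at_top_linorder)
  then show ?thesis
    by (intro that[of "max 1 T"]) auto
qed

text \<open>Beyond some threshold \<open>D\<close> is dominated by a multiple of
  \<open>t powr p\<close>, which is summable and integrable at infinity for \<open>p < - 1\<close>.
  Local integrability covers the bounded remainder.\<close>

lemma powr_decay_integrable:
  fixes D :: "real \<Rightarrow> real" and C p :: real
  assumes C: "0 < C" and p: "p < - 1" and D: "D \<sim>[at_top] (\<lambda>t. C * t powr p)"
    and nonneg: "\<And>t. 0 \<le> t \<Longrightarrow> 0 \<le> D t"
    and meas: "\<And>a. 0 \<le> a \<Longrightarrow> set_borel_measurable lborel {a..} D"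
    and int: "\<And>b. set_integrable lborel {0..b} D"
  shows "summable (\<lambda>k. D (real (Suc k)))" and "set_integrable lborel {0<..} D"
proof -
  from asymp_equiv_powr_bounds[OF C D] obtain T where T: "1 \<le> T"
    and upper: "\<And>t. T \<le> t \<Longrightarrow> D t \<le> 2 * C * t powr p"
    by metis
  have "summable (\<lambda>k. real (Suc k) powr p)"
    using p by (subst summable_Suc_iff) (simp add: summable_real_powr_iff)
  then have "summable (\<lambda>k. 2 * C * real (Suc k) powr p)"
    by (rule summable_mult)
  moreover have "\<forall>\<^sub>F k in sequentially. norm (D (real (Suc k))) \<le> 2 * C * real (Suc k) powr p"
    using eventually_ge_at_top[of "nat \<lceil>T\<rceil>"]
  proof eventually_elim
    case (elim k)
    then have "T \<le> real (Suc k)" by linarith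
    from upper[OF this] show ?case using nonneg[of "real (Suc k)"] by simp
  qed
  ultimately show "summable (\<lambda>k. D (real (Suc k)))"
    by (rule summable_comparison_test_ev[rotated])
  have "set_integrable lborel {T..} D"
  proof (rule set_integrable_bound)
    show "set_integrable lborel {T..} (\<lambda>t. 2 * C * t powr p)"
      using set_integrable_powr_Ioi[OF p, of T] T by (intro set_integrable_mult_right) simp
    show "set_borel_measurable lborel {T..} D"
      using T by (intro meas) simp
    show "AE t in lborel. t \<in> {T..} \<longrightarrow> norm (D t) \<le> norm (2 * C * t powr p)"
      using upper nonneg T C by (auto simp: abs_mult)
  qed
  then have "set_integrable lborel ({0..T} \<union> {T..}) D"
    using int[of T] by (intro set_integrable_Un) auto
  then show "set_integrable lborel {0<..} D"
    by (rule set_integrable_subset) (use T in auto)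
qed

text \<open>For \<open>p \<ge> - 1\<close> the function eventually dominates a multiple of
  \<open>1 / t\<close>. The harmonic series and the logarithm then force divergence, and
  nonnegativity upgrades it to divergence to infinity.\<close>

lemma powr_decay_not_integrable:
  fixes D :: "real \<Rightarrow> real" and C p :: real
  assumes C: "0 < C" and p: "- 1 \<le> p" and D: "D \<sim>[at_top] (\<lambda>t. C * t powr p)"
    and nonneg: "\<And>t. 0 \<le> t \<Longrightarrow> 0 \<le> D t"
    and int: "\<And>b. set_integrable lborel {0..b} D"
  shows "\<not> summable (\<lambda>k. D (real (Suc k)))"
    and "filterlim (\<lambda>N. \<Sum>n=1..N. D (real n)) at_top sequentially"
    and "filterlim (\<lambda>T. LINT t:{1..T}|lborel. D t) at_top at_top"
proof -
  from asymp_equiv_powr_bounds[OF C D] obtain T where T: "1 \<le> T"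
    and "\<And>t. T \<le> t \<Longrightarrow> C / 2 * t powr p \<le> D t"
    by metis
  moreover have "inverse t \<le> t powr p" if "1 \<le> t" for t
    using powr_mono[OF p that] that by (simp add: powr_minus)
  ultimately have lower: "C / 2 * inverse t \<le> D t" if "T \<le> t" for t
    using C that by (meson mult_left_mono half_gt_zero less_imp_le order.trans)
  show not_summable: "\<not> summable (\<lambda>k. D (real (Suc k)))"
  proof
    assume "summable (\<lambda>k. D (real (Suc k)))"
    then have "summable (\<lambda>k. 2 / C * D (real (Suc k)))"
      by (rule summable_mult)
    moreover have "\<forall>\<^sub>F k in sequentially. norm (inverse (real (Suc k))) \<le> 2 / C * D (real (Suc k))"
      using eventually_ge_at_top[of "nat \<lceil>T\<rceil>"]
    proof eventually_elim
      case (elim k)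
      then have "T \<le> real (Suc k)" by linarith
      from lower[OF this] show ?case using C by (simp add: field_simps)
    qed
    ultimately have "summable (\<lambda>k. inverse (real (Suc k)))"
      by (rule summable_comparison_test_ev[rotated])
    then have "summable (\<lambda>k. inverse (real k))"
      by (subst (asm) summable_Suc_iff)
    then show False
      using not_summable_harmonic[where 'a = real] by simp
  qed
  have eq: "(\<Sum>n=1..N. D (real n)) = (\<Sum>k<N. D (real (Suc k)))" for N
    by (simp add: sum.atLeast1_atMost_eq)
  show "filterlim (\<lambda>N. \<Sum>n=1..N. D (real n)) at_top sequentially"
    unfolding filterlim_at_top eq
  proof
    fix Z
    \<comment> \<open>If \<open>Z\<close> bounded all partial sums of this nonnegative series, the
      series would converge.\<close>
    have "\<exists>N. Z < (\<Sum>k<N. D (real (Suc k)))"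
    proof (rule ccontr)
      assume "\<not> ?thesis"
      then have "summable (\<lambda>k. D (real (Suc k)))"
        by (intro summableI_nonneg_bounded[of _ Z] nonneg) (auto simp: not_less)
      with not_summable show False ..
    qed
    then obtain N where N: "Z < (\<Sum>k<N. D (real (Suc k)))" ..
    show "\<forall>\<^sub>F n in sequentially. Z \<le> (\<Sum>k<n. D (real (Suc k)))"
      using eventually_ge_at_top[of N]
    proof eventually_elim
      case (elim n)
      have "(\<Sum>k<N. D (real (Suc k))) \<le> (\<Sum>k<n. D (real (Suc k)))"
        using elim by (intro sum_mono2 nonneg) auto
      with N show ?case by linarith
    qed
  qed
  show "filterlim (\<lambda>T. LINT t:{1..T}|lborel. D t) at_top at_top"
  proof (rule filterlim_at_top_mono)
    have "filterlim (\<lambda>S. C / 2 * (- ln T + ln S)) at_top at_top"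
      using C by (intro filterlim_tendsto_pos_mult_at_top[OF tendsto_const]
          filterlim_tendsto_add_at_top[OF tendsto_const] ln_at_top) auto
    then show "filterlim (\<lambda>S. C / 2 * (ln S - ln T)) at_top at_top"
      by simp
    show "\<forall>\<^sub>F S in at_top. C / 2 * (ln S - ln T) \<le> (LINT t:{1..S}|lborel. D t)"
      using eventually_ge_at_top[of T]
    proof eventually_elim
      case (elim S)
      have *: "has_bochner_integral lborel (\<lambda>t. inverse t * indicator {T..S} t) (ln S - ln T)"
        using T elim
        by (intro has_bochner_integral_FTC_Icc_real)
          (auto intro!: derivative_eq_intros continuous_intros simp: inverse_eq_divide)
      have "set_integrable lborel {1..S} D"
        by (rule set_integrable_subset[OF int[of S]]) auto
      \<comment> \<open>On \<open>{T..S}\<close> this is the lower bound; on the rest of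
        \<open>{1..S}\<close> the left side is 0 and \<open>D\<close> is nonnegative. The inclusion
        of the intervals uses \<open>T \<ge> 1\<close>.\<close>
      moreover have "C / 2 * (inverse t * indicator {T..S} t) \<le> indicator {1..S} t *\<^sub>R D t" for t
        using lower[of t] nonneg[of t] T by (simp add: indicator_def)
      ultimately have "(\<integral>t. C / 2 * (inverse t * indicator {T..S} t) \<partial>lborel)
          \<le> (\<integral>t. indicator {1..S} t *\<^sub>R D t \<partial>lborel)"
        using * by (intro integral_mono integrable_mult_right)
          (simp_all only: set_integrable_def has_bochner_integral_iff)
      then show ?case
        using * by (simp add: has_bochner_integral_iff set_lebesgue_integral_def)
    qed
  qed
qed

section \<open>The covariance of the increments\<close>

theorem theorem3p3:
  fixes \<alpha> \<beta> \<gamma> :: real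
    and M :: "'a measure" and W X :: "real \<Rightarrow> 'a \<Rightarrow> real"
  assumes "\<alpha> > - 1 / 2" and "\<gamma> > - 1" and "\<alpha> + \<beta> + \<gamma> > - 3 / 2"
    and "wiener_process M W"
    and "\<And>t. 0 \<le> t \<Longrightarrow> has_wiener_integral M W (volterra_kernel \<alpha> \<beta> \<gamma> t) (X t)"
  shows "((\<lambda>t. \<integral>\<omega>. X 1 \<omega> * (X (t + 1) \<omega> - X t \<omega>) \<partial>M) \<sim>[at_top]
           (\<lambda>t. Beta (2 * \<alpha> + 1) (\<gamma> + 1) / (2 * \<alpha> + \<beta> + \<gamma> + 2) * t powr (\<beta> + \<gamma>)))
    \<and> (\<beta> + \<gamma> < - 1 \<longrightarrow>
         summable (\<lambda>k. incr_cov M X (real (Suc k)))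
         \<and> set_integrable lborel {0<..} (incr_cov M X)
         \<and> short_range_dependent M X)
    \<and> (\<beta> + \<gamma> \<ge> - 1 \<longrightarrow>
         filterlim (\<lambda>N. \<Sum>n=1..N. incr_cov M X (real n)) at_top sequentially
         \<and> (\<forall>T\<ge>1. set_integrable lborel {1..T} (incr_cov M X))
         \<and> filterlim (\<lambda>T. LINT t:{1..T}|lborel. incr_cov M X t) at_top at_top
         \<and> long_range_dependent M X)"
proof -
  interpret wiener_process M W by fact
  note X = assms(5)
  define K where "K = volterra_kernel \<alpha> \<beta> \<gamma>"
  \<comment> \<open>By the isometry, \<open>R t\<close> is the mean of \<open>X 1 * X t\<close> for
    \<open>t \<ge> 0\<close>, which turns increments of the process into increments of
    \<open>R\<close>.\<close>
  define R where "R t = (\<integral>s. K 1 s * K t s \<partial>lborel)" for t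
  define C where "C = Beta (2 * \<alpha> + 1) (\<gamma> + 1) / (2 * \<alpha> + \<beta> + \<gamma> + 2)"
  have C: "0 < C"
    using assms(1-3) by (simp add: C_def Beta_real_pos)
  have K_nonneg: "0 \<le> K t s" for t s
    unfolding K_def by (rule volterra_kernel_nonneg)
  \<comment> \<open>The kernel vanishes for \<open>s \<le> 0\<close>, so set integrals over
    \<open>{0<..}\<close> become integrals over the line, for the kernel and for its square.\<close>
  have K_indicator: "(\<lambda>s. indicator {0<..} s *\<^sub>R f (K t s)) = (\<lambda>s. f (K t s))" if "f 0 = 0"
    for t and f :: "real \<Rightarrow> real"
    using that by (auto simp: K_def volterra_kernel_def)
  have K_meas [measurable]: "K t \<in> borel_measurable lborel"
    and K_L2: "integrable lborel (\<lambda>s. (K t s)\<^sup>2)"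
    and X_meas: "X t \<in> borel_measurable M" and X_L2: "integrable M (\<lambda>\<omega>. (X t \<omega>)\<^sup>2)"
    if "0 \<le> t" for t
    using X[OF that] K_indicator[of "\<lambda>x. x" t] K_indicator[of "\<lambda>x. x\<^sup>2" t]
    unfolding has_wiener_integral_def set_borel_measurable_def set_integrable_def K_def by simp_all
  have KK: "integrable lborel (\<lambda>s. K 1 s * K t s)" if "0 \<le> t" for t
    using that by (intro integrable_mult_L2 K_meas K_L2) auto
  have X_int: "integrable M (X t)" if "0 \<le> t" for t
    using square_integrable_imp_integrable[OF X_meas X_L2] that by blast
  have XX: "integrable M (\<lambda>\<omega>. X 1 \<omega> * X t \<omega>)" if "0 \<le> t" for t
    using that by (intro integrable_mult_L2 X_meas X_L2) auto
  have cov: "(\<integral>\<omega>. X 1 \<omega> * X t \<omega> \<partial>M) = R t" if "0 \<le> t" for t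
    using wiener_integral_isometry[OF X[of 1] X[OF that]]
    by (simp add: R_def K_def set_lebesgue_integral_def)
      (auto intro!: Bochner_Integration.integral_cong simp: volterra_kernel_def indicator_def)
  have E: "(\<integral>\<omega>. X 1 \<omega> * (X (t + 1) \<omega> - X t \<omega>) \<partial>M) = R (t + 1) - R t" if "0 \<le> t" for t
    using that XX[of t] XX[of "t + 1"] cov[of t] cov[of "t + 1"] by (simp add: right_diff_distrib)
  \<comment> \<open>Wiener integrals are centred, so the covariance is the mean of the
    product.\<close>
  have D: "incr_cov M X t = R (t + 1) - R t" if "0 \<le> t" for t
    using that X_int wiener_integral_expectation[OF X] E[OF that]
    by (simp add: incr_cov_def covariance_def)
  \<comment> \<open>Here \<open>K 1\<close> is a nonnegative weight and \<open>K t s\<close>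
    increases with \<open>t\<close>. Nonnegativity, measurability and local integrability of the
    covariance all follow from this.\<close>
  have R_mono: "mono_on {0..} R"
  proof (rule mono_onI)
    fix t t' :: real assume "t \<in> {0..}" "t' \<in> {0..}" "t \<le> t'"
    then show "R t \<le> R t'"
      unfolding R_def using assms(2)
      by (intro integral_mono KK mult_left_mono K_nonneg) (auto simp: K_def intro: volterra_kernel_mono)
  qed
  have D_nonneg: "0 \<le> incr_cov M X t" if "0 \<le> t" for t
    using D[OF that] mono_onD[OF R_mono, of t "t + 1"] that by simp
  have C_int: "has_bochner_integral lborel (\<lambda>s. s powr \<alpha> * K 1 s) C"
    using nn_integral_powr_volterra_kernel[OF assms(1-3)] C K_nonneg
    by (intro has_bochner_integral_nn_integral) (auto simp: C_def K_def[symmetric])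
  define r where "r t = (1 - 1 / t) powr (\<bar>\<beta>\<bar> + \<bar>\<gamma>\<bar>)" for t :: real
  have R_diff: "R (t + 1) - R t = (\<integral>s. K 1 s * (K (t + 1) s - K t s) \<partial>lborel)"
    and R_int: "integrable lborel (\<lambda>s. K 1 s * (K (t + 1) s - K t s))" if "0 \<le> t" for t
    using KK[of t] KK[of "t + 1"] that by (simp_all add: R_def right_diff_distrib)
  have lower: "r t * t powr (\<beta> + \<gamma>) * C \<le> incr_cov M X t"
    and upper: "incr_cov M X t \<le> t powr (\<beta> + \<gamma>) / r t * C" if t: "1 < t" for t
  proof -
    \<comment> \<open>The weight \<open>K 1\<close> restricts the integrals to
      \<open>0 < s < 1\<close>, where the bounds on the kernel increment are valid.\<close>
    have K_outside: "K 1 s = 0" if "\<not> (0 < s \<and> s < 1)" for s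
      using that by (auto simp: K_def volterra_kernel_def)
    have "c * (s powr \<alpha> * K 1 s) \<le> K 1 s * (K (t + 1) s - K t s)" if "c = r t * t powr (\<beta> + \<gamma>)" for c s
    proof (cases "0 < s \<and> s < 1")
      case True
      then have "K 1 s * (c * s powr \<alpha>) \<le> K 1 s * (K (t + 1) s - K t s)"
        using volterra_kernel_increment_bounds(1)[of \<gamma> s t \<beta> \<alpha>] assms(2) t
        unfolding that by (intro mult_left_mono K_nonneg) (simp add: K_def r_def)
      then show ?thesis by (simp add: mult_ac)
    qed (simp add: K_outside)
    then have "(\<integral>s. (r t * t powr (\<beta> + \<gamma>)) * (s powr \<alpha> * K 1 s) \<partial>lborel)
        \<le> (\<integral>s. K 1 s * (K (t + 1) s - K t s) \<partial>lborel)"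
      using C_int R_int[of t] t
      by (intro integral_mono integrable_mult_right) (auto simp: has_bochner_integral_iff)
    then show "r t * t powr (\<beta> + \<gamma>) * C \<le> incr_cov M X t"
      using C_int t unfolding has_bochner_integral_iff by (simp add: D R_diff)
    have "K 1 s * (K (t + 1) s - K t s) \<le> c * (s powr \<alpha> * K 1 s)" if "c = t powr (\<beta> + \<gamma>) / r t" for c s
    proof (cases "0 < s \<and> s < 1")
      case True
      then have "K 1 s * (K (t + 1) s - K t s) \<le> K 1 s * (c * s powr \<alpha>)"
        using volterra_kernel_increment_bounds(2)[of \<gamma> s t \<alpha> \<beta>] assms(2) t
        unfolding that by (intro mult_left_mono K_nonneg) (simp add: K_def r_def)
      then show ?thesis by (simp add: mult_ac)
    qed (simp add: K_outside)
    then have "(\<integral>s. K 1 s * (K (t + 1) s - K t s) \<partial>lborel)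
        \<le> (\<integral>s. (t powr (\<beta> + \<gamma>) / r t) * (s powr \<alpha> * K 1 s) \<partial>lborel)"
      using C_int R_int[of t] t
      by (intro integral_mono integrable_mult_right) (auto simp: has_bochner_integral_iff)
    then show "incr_cov M X t \<le> t powr (\<beta> + \<gamma>) / r t * C"
      using C_int t unfolding has_bochner_integral_iff by (simp add: D R_diff)
  qed
  have asymp: "incr_cov M X \<sim>[at_top] (\<lambda>t. C * t powr (\<beta> + \<gamma>))"
    using C lower upper unfolding r_def by (rule asymp_equiv_powr_sandwich)
  have meas: "set_borel_measurable lborel {a..} (incr_cov M X)" if "0 \<le> a" for a
    using that by (intro mono_increment_measurable_integrable(1)[OF R_mono D]) auto
  have int: "set_integrable lborel {0..b} (incr_cov M X)" for b
    by (intro mono_increment_measurable_integrable(2)[OF R_mono D]) auto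
  have "(\<lambda>t. \<integral>\<omega>. X 1 \<omega> * (X (t + 1) \<omega> - X t \<omega>) \<partial>M) \<sim>[at_top] (\<lambda>t. C * t powr (\<beta> + \<gamma>))"
  proof (rule asymp_equiv_trans[OF asymp_equiv_refl_ev asymp])
    show "\<forall>\<^sub>F t in at_top. (\<integral>\<omega>. X 1 \<omega> * (X (t + 1) \<omega> - X t \<omega>) \<partial>M) = incr_cov M X t"
      using eventually_ge_at_top[of 0] by eventually_elim (simp add: E D)
  qed
  moreover have "finite_second_moments M X"
    using X_meas X_L2 by (simp add: finite_second_moments_def)
  \<comment> \<open>The covariances are nonnegative, so the absolute values in the two notions of
    dependence disappear.\<close>
  moreover have "(\<lambda>k. \<bar>incr_cov M X (real (Suc k))\<bar>) = (\<lambda>k. incr_cov M X (real (Suc k)))"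
    using D_nonneg by (intro ext abs_of_nonneg) simp
  moreover have "set_integrable lborel {1..T} (incr_cov M X)" for T
    by (rule set_integrable_subset[OF int[of T]]) auto
  moreover have "summable (\<lambda>k. incr_cov M X (real (Suc k)))" "set_integrable lborel {0<..} (incr_cov M X)"
    if "\<beta> + \<gamma> < - 1"
    by (rule powr_decay_integrable[OF C that asymp D_nonneg meas int]; assumption)+
  moreover have "\<not> summable (\<lambda>k. incr_cov M X (real (Suc k)))"
      "filterlim (\<lambda>N. \<Sum>n=1..N. incr_cov M X (real n)) at_top sequentially"
      "filterlim (\<lambda>T. LINT t:{1..T}|lborel. incr_cov M X t) at_top at_top"
    if "- 1 \<le> \<beta> + \<gamma>"
    by (rule powr_decay_not_integrable[OF C that asymp D_nonneg int]; assumption)+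
  ultimately show ?thesis
    unfolding short_range_dependent_def long_range_dependent_def C_def[symmetric] by simp
qed

end
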